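(* Let $M>0$, $\mu\in(0,2]$, $\eta>0$, $C_T,B_T\ge 0$, let $\ell_1,\ldots,\ell_T$ be $\mu$-strongly convex differentiable losses on $[-\tfrac12 M,\tfrac12 M]$, and let $\hat y_t, y_t^\star\in[-\tfrac12 M,\tfrac12 M]$ for $t=1,\ldots,T$. Suppose that $$\sum_{t=1}^T(\hat y_t-y_t^\star)\,\ell_t'(\hat y_t)\le \frac{C_T}{\eta}+B_T+\eta\sum_{t=1}^T(\hat y_t-y_t^\star)^2 .$$ Then $$\sum_{t=1}^T\big(\ell_t(\hat y_t)-\ell_t(y_t^\star)\big)\le \frac{C_T}{\eta}+B_T-\Big(\frac{\mu}{2}-\eta\Big)\sum_{t=1}^T(\hat y_t-y_t^\star)^2 .$$
   Context: A differentiable function $\ell$ is $\mu$-strongly convex on $[-\tfrac12M,\tfrac12M]$ if $\ell(y)-\ell(x)\le (y-x)\ell'(y)-\frac{\mu}{2}(x-y)^2$ for all $x,y\in[-\tfrac12M,\tfrac12M]$. *)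

theory Defs
  imports "HOL-Analysis.Analysis"
begin

(* The derivative is taken within S, hence one-sided at the endpoints of a closed interval:
   a loss need only be defined on S. On a nondegenerate interval this derivative is unique,
   and it equals the ordinary one wherever the latter exists. *)
definition deriv_on :: "real set \<Rightarrow> (real \<Rightarrow> real) \<Rightarrow> real \<Rightarrow> real" where
  "deriv_on S f x = vector_derivative f (at x within S)"

definition strongly_convex_on :: "real \<Rightarrow> real set \<Rightarrow> (real \<Rightarrow> real) \<Rightarrow> bool" where
  "strongly_convex_on \<mu> S f \<longleftrightarrow>
     f differentiable_on S \<and>
     (\<forall>x\<in>S. \<forall>y\<in>S. f y - f x \<le> (y - x) * deriv_on S f y - \<mu> / 2 * (x - y)\<^sup>2)"

end

theory Submission
  imports Defs
begin

text \<open>Strong convexity, with the tangent taken at the prediction \<open>y_hat t\<close>,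
  bounds each round's regret by its linearized regret minus a quadratic bonus of weight
  \<open>\<mu> / 2\<close>. Summed over the rounds, the linearized part is what the assumed bound
  controls, and the bonus absorbs its \<open>\<eta>\<close>-weighted quadratic term.\<close>

theorem lemma1:
  fixes M \<mu> \<eta> C B :: real
    and T :: nat
    and l :: "nat \<Rightarrow> real \<Rightarrow> real"
    and y_hat y_star :: "nat \<Rightarrow> real"
  assumes "M > 0"
    and "0 < \<mu>" and "\<mu> \<le> 2"
    and "\<eta> > 0"
    and "C \<ge> 0" and "B \<ge> 0"
    and "\<And>t. t \<in> {1..T} \<Longrightarrow> strongly_convex_on \<mu> {- (M / 2)..M / 2} (l t)"
    and "\<And>t. t \<in> {1..T} \<Longrightarrow> y_hat t \<in> {- (M / 2)..M / 2}"
    and "\<And>t. t \<in> {1..T} \<Longrightarrow> y_star t \<in> {- (M / 2)..M / 2}"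
    and "(\<Sum>t=1..T. (y_hat t - y_star t) * deriv_on {- (M / 2)..M / 2} (l t) (y_hat t))
           \<le> C / \<eta> + B + \<eta> * (\<Sum>t=1..T. (y_hat t - y_star t)\<^sup>2)"
  shows "(\<Sum>t=1..T. l t (y_hat t) - l t (y_star t))
           \<le> C / \<eta> + B - (\<mu> / 2 - \<eta>) * (\<Sum>t=1..T. (y_hat t - y_star t)\<^sup>2)"
proof -
  let ?S = "{- (M / 2)..M / 2}"
  have "(\<Sum>t=1..T. l t (y_hat t) - l t (y_star t))
      \<le> (\<Sum>t=1..T. (y_hat t - y_star t) * deriv_on ?S (l t) (y_hat t)
            - \<mu> / 2 * (y_hat t - y_star t)\<^sup>2)"
  proof (rule sum_mono)
    fix t assume "t \<in> {1..T}"
    with assms(7-9) have "strongly_convex_on \<mu> ?S (l t)" "y_hat t \<in> ?S" "y_star t \<in> ?S"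
      by blast+
    then show "l t (y_hat t) - l t (y_star t)
        \<le> (y_hat t - y_star t) * deriv_on ?S (l t) (y_hat t) - \<mu> / 2 * (y_hat t - y_star t)\<^sup>2"
      \<comment> \<open>The instance is \<open>x = y_star t\<close>, \<open>y = y_hat t\<close>; its
        square comes out as \<open>(y_star t - y_hat t)\<^sup>2\<close> and has to be
        flipped.\<close>
      unfolding strongly_convex_on_def by (metis power2_commute)
  qed
  also have "\<dots> = (\<Sum>t=1..T. (y_hat t - y_star t) * deriv_on ?S (l t) (y_hat t))
      - \<mu> / 2 * (\<Sum>t=1..T. (y_hat t - y_star t)\<^sup>2)"
    by (simp add: sum_subtractf sum_distrib_left)
  finally show ?thesis
    \<comment> \<open>Inserting the linearized regret bound leaves the sum of squares with
      coefficient \<open>\<eta> - \<mu> / 2\<close>.\<close>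
    using assms(10) by (simp add: left_diff_distrib)
qed

end
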